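(* Let $x\in\mathbb{C}$ and let $\mathcal{B}_x$ be the arithmetic function $\mathcal{B}_x(k):=B_k(x)$. For $n\in\mathbb{N}$, let $\mathcal{B}_x^{-n}$ denote the inverse, with respect to the Cauchy-type product $\bullet$, of the $n$-fold product $\mathcal{B}_x\bullet\cdots\bullet\mathcal{B}_x$. Then for every $n\in\mathbb{N}$ and every $k\in\mathbb{N}_0$, $$\mathcal{B}_x^{-n}(k)=\frac{k!}{(k+n)!}\sum_{j=0}^{n}\binom{n}{j}(-1)^{n-j}(j-nx)^{k+n}.$$ In addition, $\mathcal{B}_{1-x}^{-n}(k)=(-1)^{k}\mathcal{B}_{x}^{-n}(k)$ for all $k\in\mathbb{N}_0$, and $\frac{d}{dx}\mathcal{B}_x^{-n}(k)=-nk\,\mathcal{B}_x^{-n}(k-1)$ for all $k\in\mathbb{N}$.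
   Context: An arithmetic function is a map $\mathbb{N}_0\to\mathbb{C}$, where $\mathbb{N}_0$ is the set of nonnegative integers. The Cauchy-type product of arithmetic functions $f,g$ is $(f\bullet g)(k):=\sum_{m=0}^{k}\binom{k}{m}f(m)g(k-m)$; it is commutative and associative with identity $e$, where $e(0)=1$ and $e(k)=0$ for $k>0$, and $f$ is invertible under $\bullet$ if and only if $f(0)\neq 0$. The Bernoulli polynomials $B_k(x)$ are defined by $\frac{te^{xt}}{e^t-1}=\sum_{k=0}^\infty B_k(x)\frac{t^k}{k!}$; in particular $B_0(x)=1$, so $\mathcal{B}_x$ is invertible. *)

theory Defs
  imports Complex_Main "HOL-Computational_Algebra.Formal_Power_Series"
begin

type_synonym arith_fun = "nat \<Rightarrow> complex"

definition cauchy_prod :: "arith_fun \<Rightarrow> arith_fun \<Rightarrow> arith_fun"  (infixl "\<bullet>\<^sub>C" 70) where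
  "(f \<bullet>\<^sub>C g) k = (\<Sum>m=0..k. of_nat (k choose m) * f m * g (k - m))"

definition cauchy_one :: arith_fun where
  "cauchy_one k = (if k = 0 then 1 else 0)"

definition cauchy_pow :: "arith_fun \<Rightarrow> nat \<Rightarrow> arith_fun" where
  "cauchy_pow f n = ((\<lambda>g. f \<bullet>\<^sub>C g) ^^ n) cauchy_one"

(* Meaningful only if f 0 is nonzero; see cauchy_inverse_ex1 below. *)
definition cauchy_inverse :: "arith_fun \<Rightarrow> arith_fun" where
  "cauchy_inverse f = (THE g. f \<bullet>\<^sub>C g = cauchy_one)"

(* B_k(x) is k! times the k-th coefficient of t e^(xt) / (e^t - 1), taken as a formal
   power series in t.  The divisor has zero constant term, but the division is exact;
   see bernpoly_gen_fun below. *)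
definition bernpoly :: "nat \<Rightarrow> complex \<Rightarrow> complex" where
  "bernpoly k x = fact k * fps_nth (fps_X * fps_exp x / (fps_exp 1 - 1)) k"

definition bern_fun :: "complex \<Rightarrow> arith_fun" where
  "bern_fun x = (\<lambda>k. bernpoly k x)"

definition bern_inv_pow :: "complex \<Rightarrow> nat \<Rightarrow> arith_fun" where
  "bern_inv_pow x n = cauchy_inverse (cauchy_pow (bern_fun x) n)"

lemma bernpoly_gen_fun:
  "Abs_fps (\<lambda>k. bernpoly k x / fact k) * (fps_exp 1 - 1) = fps_X * fps_exp x"
proof -
  have nz: "fps_exp (1::complex) - 1 \<noteq> 0"
  proof
    assume "fps_exp (1::complex) - 1 = 0"
    then have "fps_nth (fps_exp (1::complex) - 1) 1 = 0" by simp
    then show False by simp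
  qed
  have "subdegree (fps_exp (1::complex) - 1) = 1"
    by (intro subdegreeI) auto
  then have "fps_exp (1::complex) - 1 dvd fps_X * fps_exp x"
    using nz by (subst fps_dvd_iff) auto
  moreover have "Abs_fps (\<lambda>k. bernpoly k x / fact k) = fps_X * fps_exp x / (fps_exp 1 - 1)"
    by (simp add: fps_eq_iff bernpoly_def)
  ultimately show ?thesis by simp
qed

lemma bernpoly_0: "bernpoly 0 x = 1"
proof -
  have "fps_nth (Abs_fps (\<lambda>k. bernpoly k x / fact k) * (fps_exp 1 - 1)) 1
      = fps_nth (fps_X * fps_exp x) 1"
    by (simp only: bernpoly_gen_fun)
  then show ?thesis by (simp add: fps_mult_nth)
qed

lemma egf_cauchy_prod:
  "Abs_fps (\<lambda>k. (f \<bullet>\<^sub>C g) k / fact k)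
     = Abs_fps (\<lambda>k. f k / fact k) * Abs_fps (\<lambda>k. g k / fact k)"
proof (rule fps_ext)
  fix k
  have "of_nat (k choose m) * f m * g (k - m) / fact k = f m / fact m * (g (k - m) / fact (k - m))"
    if "m \<in> {0..k}" for m
    using that by (simp add: binomial_fact field_simps)
  then show "fps_nth (Abs_fps (\<lambda>k. (f \<bullet>\<^sub>C g) k / fact k)) k
      = fps_nth (Abs_fps (\<lambda>k. f k / fact k) * Abs_fps (\<lambda>k. g k / fact k)) k"
    by (simp add: cauchy_prod_def fps_mult_nth sum_divide_distrib)
qed

lemma cauchy_inverse_ex1:
  assumes "f 0 \<noteq> 0"
  shows "\<exists>!g. f \<bullet>\<^sub>C g = cauchy_one"
proof -
  let ?E = "\<lambda>f::arith_fun. Abs_fps (\<lambda>k. f k / fact k)"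
  have inj: "f = g" if "?E f = ?E g" for f g
    using that by (auto simp: fps_eq_iff)
  have one: "?E cauchy_one = 1"
    by (simp add: fps_eq_iff cauchy_one_def)
  have nz: "fps_nth (?E f) 0 \<noteq> 0" using assms by simp
  have iff: "f \<bullet>\<^sub>C g = cauchy_one \<longleftrightarrow> ?E f * ?E g = 1" for g
    by (metis inj one egf_cauchy_prod)
  show ?thesis
  proof (rule ex1I)
    have "?E (\<lambda>k. fact k * fps_nth (inverse (?E f)) k) = inverse (?E f)"
      by (simp add: fps_eq_iff)
    then show "f \<bullet>\<^sub>C (\<lambda>k. fact k * fps_nth (inverse (?E f)) k) = cauchy_one"
      unfolding iff using nz by (metis inverse_mult_eq_1 mult.commute)
    fix g assume "f \<bullet>\<^sub>C g = cauchy_one"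
    then have "?E f * ?E g = 1" by (simp add: iff)
    then have "?E g = inverse (?E f)" by (simp add: fps_inverse_unique)
    then have eq: "g k / fact k = fps_nth (inverse (?E f)) k" for k
      by (metis fps_nth_Abs_fps)
    then show "g = (\<lambda>k. fact k * fps_nth (inverse (?E f)) k)"
      by (intro ext) (simp flip: eq)
  qed
qed

lemma cauchy_pow_0_nonzero: "f 0 \<noteq> 0 \<Longrightarrow> cauchy_pow f n 0 \<noteq> 0"
  by (induction n) (auto simp: cauchy_pow_def cauchy_one_def cauchy_prod_def)

lemma bern_inv_pow_inverse:
  "cauchy_pow (bern_fun x) n \<bullet>\<^sub>C bern_inv_pow x n = cauchy_one"
proof -
  have "cauchy_pow (bern_fun x) n 0 \<noteq> 0"
    by (rule cauchy_pow_0_nonzero) (simp add: bern_fun_def bernpoly_0)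
  from theI'[OF cauchy_inverse_ex1[where f = "cauchy_pow (bern_fun x) n", OF this]]
  show ?thesis
    unfolding bern_inv_pow_def cauchy_inverse_def .
qed

end

theory Submission
  imports Defs
begin

text \<open>
  Passing to exponential generating functions turns \<open>\<bullet>\<^sub>C\<close> into multiplication of power series. The
  generating function of \<^term>\<open>bern_fun x\<close> is \<open>t e\<^bsup>xt\<^esup> / (e\<^bsup>t\<^esup> - 1)\<close>, so that of \<^term>\<open>bern_inv_pow x n\<close>,
  multiplied by \<open>t\<^bsup>n\<^esup>\<close>, is \<open>(e\<^bsup>t\<^esup> - 1)\<^bsup>n\<^esup> e\<^bsup>-nxt\<^esup>\<close>; expanding the power binomially gives the closed
  formula. The reflection and the derivative formula are read off from it.
\<close>

definition egf :: "arith_fun \<Rightarrow> complex fps" where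
  "egf f = Abs_fps (\<lambda>k. f k / fact k)"

lemma egf_nth: "fps_nth (egf f) k = f k / fact k"
  by (simp add: egf_def)

lemma egf_mult: "egf (f \<bullet>\<^sub>C g) = egf f * egf g"
  unfolding egf_def by (rule egf_cauchy_prod)

lemma egf_one: "egf cauchy_one = 1"
  by (simp add: fps_eq_iff egf_nth cauchy_one_def)

lemma egf_pow: "egf (cauchy_pow f n) = egf f ^ n"
  by (induction n) (simp_all add: cauchy_pow_def egf_one egf_mult)

lemma egf_bern_fun: "egf (bern_fun x) * (fps_exp 1 - 1) = fps_X * fps_exp x"
  unfolding egf_def bern_fun_def by (rule bernpoly_gen_fun)

text \<open>The series \<open>fps_exp 1 - 1\<close> has zero constant term and hence no inverse, so
  \<open>fps_X ^ n\<close> stays on the left instead of being divided out.\<close>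

lemma egf_bern_inv_pow:
  "fps_X ^ n * egf (bern_inv_pow x n) = (fps_exp 1 - 1) ^ n * fps_exp (- (of_nat n * x))"
proof -
  let ?B = "egf (bern_fun x)" and ?G = "egf (bern_inv_pow x n)"
  have exp_cancel: "fps_exp (of_nat n * x) * fps_exp (- (of_nat n * x)) = 1"
    by (simp flip: fps_exp_add_mult)
  have inverse: "?B ^ n * ?G = 1"
    using bern_inv_pow_inverse[of x n] by (metis egf_mult egf_one egf_pow)
  have power: "?B ^ n * (fps_exp 1 - 1) ^ n = fps_X ^ n * fps_exp (of_nat n * x)"
    by (metis egf_bern_fun power_mult_distrib fps_exp_power_mult)
  \<comment> \<open>Inserting \<open>exp_cancel\<close> produces the right-hand side of
    \<open>power\<close>, which brings in \<open>?B ^ n\<close> to cancel against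
    \<open>?G\<close>.\<close>
  have "fps_X ^ n * ?G = (fps_X ^ n * fps_exp (of_nat n * x)) * ?G * fps_exp (- (of_nat n * x))"
    using exp_cancel by (simp add: ac_simps)
  also have "\<dots> = (?B ^ n * ?G) * ((fps_exp 1 - 1) ^ n * fps_exp (- (of_nat n * x)))"
    unfolding power [symmetric] by (simp only: ac_simps)
  finally show ?thesis
    by (simp add: inverse)
qed

text \<open>Binomial expansion leaves a combination of the exponentials
  \<open>fps_exp (of_nat j + c)\<close>, whose coefficients are explicit.\<close>

lemma fps_exp_minus_one_power_mult_exp_nth:
  fixes c :: complex
  shows "fps_nth ((fps_exp 1 - 1) ^ n * fps_exp c) m =
    (\<Sum>j=0..n. of_nat (n choose j) * (-1) ^ (n - j) * (of_nat j + c) ^ m) / fact m"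
proof -
  \<comment> \<open>With scalars written as constant series, taking a coefficient becomes scalar
    multiplication.\<close>
  have coeff: "of_nat (n choose j) * (-1) ^ (n - j) =
      fps_const (of_nat (n choose j) * (-1) ^ (n - j) :: complex)" for j
    by (simp flip: fps_of_nat fps_const_mult fps_const_neg fps_const_power)
  have "(fps_exp 1 - 1 :: complex fps) ^ n * fps_exp c
      = (\<Sum>j=0..n. of_nat (n choose j) * fps_exp 1 ^ j * (-1) ^ (n - j)) * fps_exp c"
    using binomial_ring[of "fps_exp (1::complex)" "-1" n] by (simp add: atLeast0AtMost)
  also have "\<dots> = (\<Sum>j=0..n. fps_const (of_nat (n choose j) * (-1) ^ (n - j)) * fps_exp (of_nat j + c))"
    unfolding sum_distrib_right
    by (intro sum.cong refl) (simp add: fps_exp_power_mult fps_exp_add_mult ac_simps flip: coeff)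
  finally show ?thesis
    by (simp add: fps_sum_nth sum_divide_distrib)
qed

lemma bern_inv_pow_eq:
  "bern_inv_pow x n k = fact k / fact (k + n) *
     (\<Sum>j=0..n. of_nat (n choose j) * (-1) ^ (n - j) * (of_nat j - of_nat n * x) ^ (k + n))"
proof -
  \<comment> \<open>Multiplication by \<open>fps_X ^ n\<close> shifts indices by \<open>n\<close>;
    this is the origin of \<open>k + n\<close> in the formula.\<close>
  have "bern_inv_pow x n k / fact k = fps_nth (fps_X ^ n * egf (bern_inv_pow x n)) (k + n)"
    by (simp add: fps_X_power_mult_nth egf_nth)
  also have "\<dots> = (\<Sum>j=0..n. of_nat (n choose j) * (-1) ^ (n - j) *
      (of_nat j - of_nat n * x) ^ (k + n)) / fact (k + n)"
    by (simp add: egf_bern_inv_pow fps_exp_minus_one_power_mult_exp_nth)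
  finally show ?thesis
    by (simp add: field_simps)
qed

text \<open>Reversing the summation, \<open>j\<close> to \<open>n - j\<close>, turns each base into
  the negative of the base in the formula for \<open>x\<close>.\<close>

lemma bern_inv_pow_reflect: "bern_inv_pow (1 - x) n k = (-1) ^ k * bern_inv_pow x n k"
proof -
  have summand: "of_nat (n choose (n - j)) * (-1) ^ (n - (n - j)) *
        (of_nat (n - j) - of_nat n * (1 - x)) ^ (k + n)
      = (-1) ^ k * (of_nat (n choose j) * (-1) ^ (n - j) * (of_nat j - of_nat n * x) ^ (k + n))"
    if "j \<le> n" for j
  proof -
    have base: "of_nat (n - j) - of_nat n * (1 - x) = (-1) * (of_nat j - of_nat n * x)"
      using that by (simp add: of_nat_diff algebra_simps)
    have "(-1) ^ n = (-1 :: complex) ^ j * (-1) ^ (n - j)"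
      using that by (simp flip: power_add)
    \<comment> \<open>Splitting \<open>(-1) ^ n\<close> makes \<open>(-1) ^ j\<close> occur twice,
      so it cancels.\<close>
    then have sign: "(-1) ^ j * (-1) ^ (k + n) = (-1 :: complex) ^ k * (-1) ^ (n - j)"
      by (simp add: power_add ac_simps)
    show ?thesis
      using that unfolding base power_mult_distrib
      by (simp add: binomial_symmetric [symmetric] sign [symmetric] ac_simps)
  qed
  have "(\<Sum>j=0..n. of_nat (n choose j) * (-1) ^ (n - j) * (of_nat j - of_nat n * (1 - x)) ^ (k + n))
      = (\<Sum>j=0..n. of_nat (n choose (n - j)) * (-1) ^ (n - (n - j)) *
          (of_nat (n - j) - of_nat n * (1 - x)) ^ (k + n))"
    by (subst sum.atLeastAtMost_rev) simp
  also have "\<dots> = (-1) ^ k *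
      (\<Sum>j=0..n. of_nat (n choose j) * (-1) ^ (n - j) * (of_nat j - of_nat n * x) ^ (k + n))"
    unfolding sum_distrib_left by (intro sum.cong refl summand) simp
  finally show ?thesis
    by (simp add: bern_inv_pow_eq)
qed

text \<open>Termwise differentiation lowers the exponent to \<open>k + n\<close>, the one belonging
  to index \<open>k\<close>. Using \<open>Suc k\<close> avoids truncated subtraction.\<close>

lemma bern_inv_pow_has_field_derivative:
  "((\<lambda>y. bern_inv_pow y n (Suc k)) has_field_derivative
     - (of_nat n * of_nat (Suc k) * bern_inv_pow x n k)) (at x)"
proof -
  let ?c = "\<lambda>j. of_nat (n choose j) * (-1) ^ (n - j) :: complex"
  let ?S = "\<Sum>j=0..n. ?c j * (of_nat j - of_nat n * x) ^ (k + n)"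
  have "((\<lambda>y. fact (Suc k) / fact (Suc k + n) *
      (\<Sum>j=0..n. ?c j * (of_nat j - of_nat n * y) ^ (Suc k + n))) has_field_derivative
      fact (Suc k) / fact (Suc k + n) * (\<Sum>j=0..n. ?c j *
        (of_nat (Suc k + n) * (of_nat j - of_nat n * x) ^ (k + n) * - of_nat n))) (at x)"
    by (rule derivative_eq_intros refl)+ (simp del: power_Suc of_nat_Suc of_nat_add add: ac_simps)
  also have "(\<Sum>j=0..n. ?c j *
        (of_nat (Suc k + n) * (of_nat j - of_nat n * x) ^ (k + n) * - of_nat n))
      = of_nat (Suc (k + n)) * - of_nat n * ?S"
    unfolding sum_distrib_left by (intro sum.cong) (simp_all add: ac_simps)
  \<comment> \<open>The factor \<open>Suc (k + n)\<close> from the power rule cancels in the larger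
    factorial, while \<open>fact (Suc k)\<close> releases \<open>Suc k\<close>.\<close>
  also have "fact (Suc k) / fact (Suc k + n) * (of_nat (Suc (k + n)) * - of_nat n * ?S)
      = - (of_nat n * of_nat (Suc k) * (fact k / fact (k + n) * ?S))"
    by (simp add: fact_Suc del: of_nat_Suc)
  finally show ?thesis
    unfolding bern_inv_pow_eq .
qed

theorem theorem3:
  fixes x :: complex and n :: nat
  assumes "n \<ge> 1"
  shows "(\<forall>k::nat. bern_inv_pow x n k =
            fact k / fact (k + n) *
            (\<Sum>j=0..n. of_nat (n choose j) * (-1) ^ (n - j) * (of_nat j - of_nat n * x) ^ (k + n)))
       \<and> (\<forall>k::nat. bern_inv_pow (1 - x) n k = (-1) ^ k * bern_inv_pow x n k)
       \<and> (\<forall>k::nat. k \<ge> 1 \<longrightarrow>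
            ((\<lambda>y. bern_inv_pow y n k) has_field_derivative
               - (of_nat n * of_nat k * bern_inv_pow x n (k - 1))) (at x))"
proof (intro conjI allI impI)
  fix k :: nat
  assume "k \<ge> 1"
  then obtain m where "k = Suc m"
    by (cases k) auto
  then show "((\<lambda>y. bern_inv_pow y n k) has_field_derivative
      - (of_nat n * of_nat k * bern_inv_pow x n (k - 1))) (at x)"
    using bern_inv_pow_has_field_derivative[of n m x] by simp
qed (rule bern_inv_pow_eq bern_inv_pow_reflect)+

end
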